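(* Let $1\le\delta<\Delta$ be integers with $\delta\Delta$ odd, $\tilde h:\mathbb{Z}^+\to\mathbb{R}^+$ a positive non-increasing function and $\mathcal{J}(G)=\sum_{u\in V(G)}\tilde h(d_u)$. If $G\in\mathcal{L}_{\delta,\Delta}$, then $G$ is minimal for $\mathcal{J}$ on $\mathfrak{G}^{\Delta+3}_{\delta,\Delta}$. Moreover, if $\tilde h(\Delta-1)>\tilde h(\Delta)$, then a graph $G\in\mathfrak{G}^{\Delta+3}_{\delta,\Delta}$ is minimal for $\mathcal{J}$ on $\mathfrak{G}^{\Delta+3}_{\delta,\Delta}$ if and only if $G\in\mathcal{L}_{\delta,\Delta}$.
   Context: All graphs are finite and simple; $d_u$ is the degree of $u$. $\mathfrak{G}^n_{\delta,\Delta}$ is the family of graphs with $n$ vertices, minimum degree $\delta$ and maximum degree $\Delta$. $\mathcal{L}_{\delta,\Delta}$ is the family of graphs having exactly $\Delta+3$ vertices, namely a unique vertex of degree $\delta$ and $\Delta+2$ vertices of degree $\Delta$. A graph $G$ in a family $\mathcal{F}$ is minimal for $\mathcal{J}$ on $\mathcal{F}$ if $\mathcal{J}(G)\le\mathcal{J}(\Gamma)$ for all $\Gamma\in\mathcal{F}$. *)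

theory Defs
  imports "Graph_Theory.Pair_Digraph"
begin

text \<open>
  A finite simple graph is a \<open>pair_graph\<close>: an undirected edge \<open>uv\<close> is represented by the two
  arcs \<open>(u, v)\<close> and \<open>(v, u)\<close>, so the degree of a vertex is its out-degree.
\<close>

definition vdeg :: "'a pair_pre_digraph \<Rightarrow> 'a \<Rightarrow> nat" where
  "vdeg G u = out_degree (with_proj G) u"

definition min_deg :: "'a pair_pre_digraph \<Rightarrow> nat" where
  "min_deg G = Min (vdeg G ` pverts G)"

definition max_deg :: "'a pair_pre_digraph \<Rightarrow> nat" where
  "max_deg G = Max (vdeg G ` pverts G)"

text \<open>The null graph is excluded, since \<open>Min {}\<close> and \<open>Max {}\<close> are unspecified.\<close>

definition graph_family :: "nat \<Rightarrow> nat \<Rightarrow> nat \<Rightarrow> 'a pair_pre_digraph set" where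
  "graph_family n \<delta> \<Delta> =
     {G. pair_graph G \<and> pverts G \<noteq> {} \<and> card (pverts G) = n \<and> min_deg G = \<delta> \<and> max_deg G = \<Delta>}"

definition L_family :: "nat \<Rightarrow> nat \<Rightarrow> 'a pair_pre_digraph set" where
  "L_family \<delta> \<Delta> =
     {G. pair_graph G \<and> card (pverts G) = \<Delta> + 3 \<and>
         (\<exists>!u. u \<in> pverts G \<and> vdeg G u = \<delta>) \<and>
         card {u \<in> pverts G. vdeg G u = \<Delta>} = \<Delta> + 2}"

definition J_index :: "(nat \<Rightarrow> real) \<Rightarrow> 'a pair_pre_digraph \<Rightarrow> real" where
  "J_index h G = (\<Sum>u\<in>pverts G. h (vdeg G u))"

definition minimal_on :: "('g \<Rightarrow> real) \<Rightarrow> 'g set \<Rightarrow> 'g \<Rightarrow> bool" where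
  "minimal_on J \<F> G \<longleftrightarrow> G \<in> \<F> \<and> (\<forall>\<Gamma>\<in>\<F>. J G \<le> J \<Gamma>)"

end

theory Submission
  imports Defs
begin

text \<open>
  A graph in the family has a vertex of degree \<open>\<delta>\<close>, and each of the other \<open>\<Delta> + 2\<close> vertices contributes
  at least \<open>h \<Delta>\<close>; the bound \<open>h \<delta> + (\<Delta> + 2) h \<Delta>\<close> is attained exactly on \<open>\<L>\<close> when \<open>h (\<Delta> - 1) > h \<Delta>\<close>,
  provided that \<open>\<L>\<close> is nonempty. Nonemptiness is seen on the complement, which needs one vertex of
  even degree \<open>\<Delta> + 2 - \<delta>\<close> and all others of degree 2: take cycles that share one vertex and are
  otherwise disjoint, all of them triangles except one of length \<open>\<delta> + 3\<close>.
\<close>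

section \<open>Graphs built from a relation on a vertex set\<close>

definition rel_graph :: "'a set \<Rightarrow> ('a \<Rightarrow> 'a \<Rightarrow> bool) \<Rightarrow> 'a pair_pre_digraph" where
  "rel_graph V R = \<lparr>pverts = V, parcs = {(u, v). u \<in> V \<and> v \<in> V \<and> R u v}\<rparr>"

lemma pverts_rel_graph [simp]: "pverts (rel_graph V R) = V"
  by (simp add: rel_graph_def)

lemma pair_graph_rel_graph:
  assumes "finite V" and "\<And>u v. u \<in> V \<Longrightarrow> v \<in> V \<Longrightarrow> R u v \<Longrightarrow> R v u"
    and "\<And>u. u \<in> V \<Longrightarrow> \<not> R u u"
  shows "pair_graph (rel_graph V R)"
proof -
  have "finite {(u, v). u \<in> V \<and> v \<in> V \<and> R u v}"
    by (rule finite_subset[of _ "V \<times> V"]) (use assms(1) in auto)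
  moreover have "symmetric (with_proj (rel_graph V R))"
    unfolding symmetric_def with_proj_simps rel_graph_def using assms(2) by (auto intro: symI)
  ultimately show ?thesis
    using assms(1,3) by unfold_locales (auto simp: rel_graph_def)
qed

lemma vdeg_rel_graph:
  assumes "u \<in> V"
  shows "vdeg (rel_graph V R) u = card {v \<in> V. R u v}"
proof -
  have "out_arcs (with_proj (rel_graph V R)) u = Pair u ` {v \<in> V. R u v}"
    using assms by (auto simp: rel_graph_def out_arcs_def)
  then show ?thesis
    by (simp add: vdeg_def out_degree_def card_image inj_on_def)
qed

section \<open>The extremal graph as the complement of a flower of cycles\<close>

text \<open>
  Closed neighbourhoods of the complement on the vertices \<open>0, \<dots>, n - 1\<close>, with \<open>0\<close> the common vertex
  of degree \<open>m\<close>. The triangles are \<open>{0, j, j + 1}\<close> for odd \<open>j < m - 1\<close>; the remaining cycle is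
  \<open>0, m - 1, m, \<dots>, n - 1\<close>.
\<close>

definition flower_nbhd :: "nat \<Rightarrow> nat \<Rightarrow> nat \<Rightarrow> nat set" where
  "flower_nbhd n m j =
     (if j = 0 then insert (n - 1) {..<m}
      else if j = n - 1 then {0, n - 2, n - 1}
      else if j < m then (if odd j then {0, j, j + 1} else {0, j - 1, j})
      else {j - 1, j, j + 1})"

lemma flower_nbhd_self: "0 < m \<Longrightarrow> j \<in> flower_nbhd n m j"
  by (auto simp: flower_nbhd_def)

text \<open>Since \<open>m\<close> is even, the vertices from 1 to \<open>m - 2\<close> pair off
  into triangles with 0. The vertex \<open>m - 1\<close> is then odd, and its branch links it to 0
  and to \<open>m\<close>, where the path up to \<open>n - 1\<close> continues.\<close>

lemma flower_nbhd_sym: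
  assumes "even m" "0 < m" "m + 2 \<le> n" "j < n" "i \<in> flower_nbhd n m j"
  shows "j \<in> flower_nbhd n m i"
proof -
  consider "j = 0" | "j \<noteq> 0" "j = n - 1" | "odd j" "j < m" | "j \<noteq> 0" "even j" "j < m"
    | "m \<le> j" "j \<noteq> n - 1"
    by linarith
  then show ?thesis
  proof cases
    case 1
    then show ?thesis using assms by (auto simp: flower_nbhd_def)
  next
    case 2
    then have "i = 0 \<or> i = n - 2 \<or> i = n - 1"
      using assms by (simp add: flower_nbhd_def)
    then show ?thesis
      using 2 assms by (elim disjE) (auto simp: flower_nbhd_def)
  next
    case 3
    then have "i = 0 \<or> i = j \<or> i = j + 1"
      using assms by (auto simp: flower_nbhd_def split: if_splits)
    then show ?thesis
      using 3 assms by (elim disjE) (auto simp: flower_nbhd_def)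
  next
    case 4
    then have "i = 0 \<or> i = j - 1 \<or> i = j"
      using assms by (auto simp: flower_nbhd_def split: if_splits)
    then show ?thesis
      using 4 assms by (elim disjE) (auto simp: flower_nbhd_def)
  next
    case 5
    then have "i = j - 1 \<or> i = j \<or> i = j + 1"
      using assms by (auto simp: flower_nbhd_def split: if_splits)
    \<comment> \<open>The predecessor leaves the path branch only at \<open>j = m\<close>; there
      \<open>m - 1\<close> is odd and its neighbourhood \<open>{0, m - 1, m}\<close> contains
      \<open>j\<close>.\<close>
    moreover have "j = m" if "j - 1 < m"
      using that 5 by linarith
    ultimately show ?thesis
      using 5 assms by (elim disjE) (auto simp: flower_nbhd_def)
  qed
qed

lemma flower_nbhd_subset:
  assumes "even m" "0 < m" "m + 2 \<le> n" "j < n"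
  shows "flower_nbhd n m j \<subseteq> {..<n}"
  using assms by (auto simp: flower_nbhd_def split: if_splits)

text \<open>The listed elements are distinct: \<open>n - 2\<close> and \<open>n - 1\<close> are at
  least \<open>m\<close>, and evenness gives \<open>m \<ge> 2\<close> as well as
  \<open>j - 1 > 0\<close> in the branch of even nonzero \<open>j\<close>.\<close>

lemma card_flower_nbhd:
  assumes "even m" "0 < m" "m + 2 \<le> n" "j < n"
  shows "card (flower_nbhd n m j) = (if j = 0 then m + 1 else 3)"
  using assms by (auto simp: flower_nbhd_def card_insert_if elim: oddE)

text \<open>The vertex set is prescribed because \<open>'a\<close> may be a finite type; a given
  graph of the family will supply a set of the right size.\<close>

lemma L_family_nonempty:
  fixes V :: "'a set"
  assumes \<delta>: "1 \<le> \<delta>" "\<delta> < \<Delta>" and "odd (\<delta> * \<Delta>)"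
    and V: "finite V" "card V = \<Delta> + 3"
  shows "\<exists>G :: 'a pair_pre_digraph. G \<in> L_family \<delta> \<Delta>"
proof -
  define n m where "n = \<Delta> + 3" and "m = \<Delta> + 2 - \<delta>"
  \<comment> \<open>\<open>m\<close> is even because \<delta> and \<Delta> are both odd, and
    \<open>m + 2 \<le> n\<close> amounts to \<open>1 \<le> \<delta>\<close>.\<close>
  have m: "even m" "0 < m" "m + 2 \<le> n"
    using assms by (auto simp: n_def m_def)
  obtain g where g: "bij_betw g V {..<n}"
    using V finite_same_card_bij[of V "{..<n}"] by (auto simp: n_def)
  \<comment> \<open>Complements of closed neighbourhoods exclude loops automatically.\<close>
  define R where "R u v \<longleftrightarrow> g v \<notin> flower_nbhd n m (g u)" for u v
  define G where "G = rel_graph V R"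
  have g_less: "g u < n" if "u \<in> V" for u
    using g that by (auto simp: bij_betw_def)
  have G: "pair_graph G" unfolding G_def
  proof (rule pair_graph_rel_graph)
    show "R v u" if "u \<in> V" "v \<in> V" "R u v" for u v
      using that flower_nbhd_sym[OF m g_less] by (auto simp: R_def)
  qed (use V m flower_nbhd_self in \<open>auto simp: R_def\<close>)
  have deg: "vdeg G u = (if g u = 0 then \<delta> else \<Delta>)" if u: "u \<in> V" for u
  proof -
    note gu = g_less[OF u]
    have "bij_betw g {v \<in> V. R u v} ({..<n} - flower_nbhd n m (g u))"
      using g by (auto simp: bij_betw_def R_def inj_on_def)
    then have "vdeg G u = card ({..<n} - flower_nbhd n m (g u))"
      using u by (simp add: G_def vdeg_rel_graph bij_betw_same_card)
    also have "\<dots> = n - card (flower_nbhd n m (g u))"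
      using flower_nbhd_subset[OF m gu] by (simp add: card_Diff_subset finite_subset)
    \<comment> \<open>The degrees come out as \<open>n - (m + 1) = \<delta>\<close> and
      \<open>n - 3 = \<Delta>\<close>.\<close>
    finally show ?thesis
      using card_flower_nbhd[OF m gu] \<delta> by (auto simp: n_def m_def)
  qed
  obtain w where w: "w \<in> V" "g w = 0"
    using g by (force simp: n_def bij_betw_def)
  have g0: "g u = 0 \<longleftrightarrow> u = w" if "u \<in> V" for u
    using g w that by (auto simp: bij_betw_def inj_on_def)
  have "{u \<in> V. vdeg G u = \<Delta>} = V - {w}"
    using deg g0 \<delta> by auto
  then have "card {u \<in> V. vdeg G u = \<Delta>} = \<Delta> + 2"
    using V w by simp
  moreover have "\<exists>!u. u \<in> V \<and> vdeg G u = \<delta>"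
    using deg g0 \<delta> w by (metis nat_neq_iff)
  ultimately have "G \<in> L_family \<delta> \<Delta>"
    using G V by (simp add: L_family_def G_def)
  then show ?thesis ..
qed

section \<open>Degrees and index values in the two families\<close>

lemma finite_pverts:
  assumes "pair_graph G"
  shows "finite (pverts G)"
proof -
  interpret pair_graph G by fact
  show ?thesis by (rule pair_finite_verts)
qed

lemma graph_family_degree_bounds:
  assumes "G \<in> graph_family n \<delta> \<Delta>" "u \<in> pverts G"
  shows "\<delta> \<le> vdeg G u" "vdeg G u \<le> \<Delta>"
  using assms finite_pverts[of G]
  by (auto simp: graph_family_def min_deg_def max_deg_def)

lemma graph_family_min_vertex:
  assumes "G \<in> graph_family n \<delta> \<Delta>"
  obtains w where "w \<in> pverts G" "vdeg G w = \<delta>"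
proof -
  have "Min (vdeg G ` pverts G) \<in> vdeg G ` pverts G"
    using assms finite_pverts[of G] by (intro Min_in) (auto simp: graph_family_def)
  then show thesis
    using assms that by (auto simp: graph_family_def min_deg_def)
qed

text \<open>As \<delta> and \<Delta> differ, the vertices of degree \<Delta> lie in
  \<open>pverts G - {w}\<close>; both sets have \<Delta> + 2 elements, so they coincide.\<close>

lemma L_family_split:
  assumes "G \<in> L_family \<delta> \<Delta>" "\<delta> < \<Delta>"
  obtains w where "w \<in> pverts G" "vdeg G w = \<delta>" "\<And>u. u \<in> pverts G - {w} \<Longrightarrow> vdeg G u = \<Delta>"
proof -
  from assms obtain w where w: "w \<in> pverts G" "vdeg G w = \<delta>"
    by (auto simp: L_family_def)
  have fin: "finite (pverts G)"
    using assms finite_pverts by (auto simp: L_family_def)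
  have "{u \<in> pverts G. vdeg G u = \<Delta>} = pverts G - {w}"
    using assms w fin by (intro card_subset_eq) (auto simp: L_family_def)
  with w that show thesis by blast
qed

lemma J_index_eq:
  assumes "finite (pverts G)" "w \<in> pverts G" "vdeg G w = \<delta>"
  shows "J_index h G = h \<delta> + (\<Sum>u \<in> pverts G - {w}. h (vdeg G u))"
  using assms by (simp add: J_index_def sum.remove)

lemma L_family_subset_graph_family:
  assumes "\<delta> < \<Delta>" and G: "G \<in> L_family \<delta> \<Delta>"
  shows "G \<in> graph_family (\<Delta> + 3) \<delta> \<Delta>"
proof -
  obtain w where w: "w \<in> pverts G" "vdeg G w = \<delta>" "\<And>u. u \<in> pverts G - {w} \<Longrightarrow> vdeg G u = \<Delta>"
    using L_family_split[OF G assms(1)] by blast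
  have card: "card (pverts G) = \<Delta> + 3" and pg: "pair_graph G"
    using G by (auto simp: L_family_def)
  have "card (pverts G - {w}) = \<Delta> + 2"
    using card w finite_pverts[OF pg] by simp
  \<comment> \<open>Some vertex besides \<open>w\<close> is required for \<Delta> to be attained as
    the maximum.\<close>
  then have "pverts G - {w} \<noteq> {}" by (metis add_is_0 card.empty zero_neq_numeral)
  then have "vdeg G ` (pverts G - {w}) = {\<Delta>}" using w(3) by auto
  then have "vdeg G ` pverts G = {\<delta>, \<Delta>}"
    using w(1,2) by (metis image_insert insert_Diff)
  then show ?thesis
    using assms(1) w(1) card pg by (auto simp: graph_family_def min_deg_def max_deg_def)
qed

lemma J_index_L_family:
  assumes "\<delta> < \<Delta>" and G: "G \<in> L_family \<delta> \<Delta>"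
  shows "J_index h G = h \<delta> + real (\<Delta> + 2) * h \<Delta>"
proof -
  obtain w where w: "w \<in> pverts G" "vdeg G w = \<delta>" "\<And>u. u \<in> pverts G - {w} \<Longrightarrow> vdeg G u = \<Delta>"
    using L_family_split[OF G assms(1)] by blast
  have fin: "finite (pverts G)" and card: "card (pverts G) = \<Delta> + 3"
    using G finite_pverts by (auto simp: L_family_def)
  have "(\<Sum>u \<in> pverts G - {w}. h (vdeg G u)) = (\<Sum>u \<in> pverts G - {w}. h \<Delta>)"
    using w(3) by (intro sum.cong) auto
  then show ?thesis
    using J_index_eq[OF fin w(1,2)] fin card w(1) by simp
qed

section \<open>The lower bound and its equality case\<close>

lemma J_index_lower_bound:
  assumes "1 \<le> \<delta>" "antimono_on {1..} h" and G: "G \<in> graph_family (\<Delta> + 3) \<delta> \<Delta>"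
  shows "h \<delta> + real (\<Delta> + 2) * h \<Delta> \<le> J_index h G"
proof -
  obtain w where w: "w \<in> pverts G" "vdeg G w = \<delta>"
    using graph_family_min_vertex[OF G] .
  have fin: "finite (pverts G)" and card: "card (pverts G) = \<Delta> + 3"
    using G finite_pverts by (auto simp: graph_family_def)
  have "(\<Sum>u \<in> pverts G - {w}. h \<Delta>) \<le> (\<Sum>u \<in> pverts G - {w}. h (vdeg G u))"
  proof (rule sum_mono)
    fix u assume "u \<in> pverts G - {w}"
    \<comment> \<open>The bound \<open>1 \<le> \<delta>\<close> keeps every degree in the range
      where \<open>h\<close> is antitone.\<close>
    then show "h \<Delta> \<le> h (vdeg G u)"
      using graph_family_degree_bounds[OF G, of u] assms(1,2) by (auto simp: monotone_on_def)
  qed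
  then show ?thesis
    using J_index_eq[OF fin w] fin card w(1) by simp
qed

text \<open>Termwise the sum away from \<open>w\<close> is at least that of
  \<open>h \<Delta>\<close>, so equality of the sums forces equality of all terms. A degree below
  \<Delta> would give a term of at least \<open>h (\<Delta> - 1)\<close>, which is too
  large.\<close>

lemma L_family_if_J_index_le:
  assumes \<delta>: "1 \<le> \<delta>" "\<delta> < \<Delta>" and anti: "antimono_on {1..} h" and less: "h \<Delta> < h (\<Delta> - 1)"
    and G: "G \<in> graph_family (\<Delta> + 3) \<delta> \<Delta>"
    and le: "J_index h G \<le> h \<delta> + real (\<Delta> + 2) * h \<Delta>"
  shows "G \<in> L_family \<delta> \<Delta>"
proof -
  obtain w where w: "w \<in> pverts G" "vdeg G w = \<delta>"
    using graph_family_min_vertex[OF G] .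
  have pg: "pair_graph G" and fin: "finite (pverts G)" and card: "card (pverts G) = \<Delta> + 3"
    using G finite_pverts by (auto simp: graph_family_def)
  have ge: "h \<Delta> \<le> h (vdeg G u)" if "u \<in> pverts G" for u
    using graph_family_degree_bounds[OF G that] \<delta> anti by (auto simp: monotone_on_def)
  have "(\<Sum>u \<in> pverts G - {w}. h (vdeg G u)) \<le> (\<Sum>u \<in> pverts G - {w}. h \<Delta>)"
    using le J_index_eq[OF fin w, of h] fin card w(1) by simp
  then have "(\<Sum>u \<in> pverts G - {w}. h \<Delta>) = (\<Sum>u \<in> pverts G - {w}. h (vdeg G u))"
    using ge by (intro antisym[OF sum_mono]) auto
  then have eq: "h \<Delta> = h (vdeg G u)" if "u \<in> pverts G - {w}" for u
    by (rule sum_mono_inv) (use that ge fin in auto)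
  have deg: "vdeg G u = \<Delta>" if u: "u \<in> pverts G - {w}" for u
  proof (rule ccontr)
    assume "vdeg G u \<noteq> \<Delta>"
    then have "1 \<le> vdeg G u" "vdeg G u \<le> \<Delta> - 1"
      using graph_family_degree_bounds[OF G, of u] \<delta> u by auto
    then have "h (\<Delta> - 1) \<le> h (vdeg G u)"
      using anti by (auto simp: monotone_on_def)
    with eq[OF u] less show False by simp
  qed
  have "{u \<in> pverts G. vdeg G u = \<Delta>} = pverts G - {w}"
    using deg w \<delta> by auto
  then have "card {u \<in> pverts G. vdeg G u = \<Delta>} = \<Delta> + 2"
    using fin card w(1) by simp
  moreover have "\<exists>!u. u \<in> pverts G \<and> vdeg G u = \<delta>"
    using w deg \<delta> by (metis Diff_iff nat_neq_iff singletonD)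
  ultimately show ?thesis
    using pg card by (simp add: L_family_def)
qed

theorem theorem2p15:
  fixes \<delta> \<Delta> :: nat and h :: "nat \<Rightarrow> real"
  assumes "1 \<le> \<delta>" and "\<delta> < \<Delta>" and "odd (\<delta> * \<Delta>)"
    and "\<forall>k\<ge>1. h k > 0"
    and "antimono_on {1..} h"
  shows "(\<forall>G :: 'a pair_pre_digraph. G \<in> L_family \<delta> \<Delta> \<longrightarrow>
            minimal_on (J_index h) (graph_family (\<Delta> + 3) \<delta> \<Delta>) G) \<and>
         (h (\<Delta> - 1) > h \<Delta> \<longrightarrow>
            (\<forall>G :: 'a pair_pre_digraph. G \<in> graph_family (\<Delta> + 3) \<delta> \<Delta> \<longrightarrow>
               (minimal_on (J_index h) (graph_family (\<Delta> + 3) \<delta> \<Delta>) G \<longleftrightarrow> G \<in> L_family \<delta> \<Delta>)))"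
proof -
  have min: "minimal_on (J_index h) (graph_family (\<Delta> + 3) \<delta> \<Delta>) G"
    if "G \<in> L_family \<delta> \<Delta>" for G :: "'a pair_pre_digraph"
    unfolding minimal_on_def J_index_L_family[OF assms(2) that]
    using L_family_subset_graph_family[OF assms(2) that] J_index_lower_bound[OF assms(1,5)] by blast
  moreover have "G \<in> L_family \<delta> \<Delta>"
    if less: "h \<Delta> < h (\<Delta> - 1)" and G: "G \<in> graph_family (\<Delta> + 3) \<delta> \<Delta>"
      and minimal: "minimal_on (J_index h) (graph_family (\<Delta> + 3) \<delta> \<Delta>) G"
    for G :: "'a pair_pre_digraph"
  proof -
    \<comment> \<open>A member of the family on the vertices of \<open>G\<close> itself shows that
      the minimum does not exceed the lower bound.\<close>
    obtain \<Gamma> :: "'a pair_pre_digraph" where \<Gamma>: "\<Gamma> \<in> L_family \<delta> \<Delta>"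
      using L_family_nonempty[OF assms(1-3), of "pverts G"] G finite_pverts[of G]
      by (auto simp: graph_family_def)
    have "J_index h G \<le> J_index h \<Gamma>"
      using minimal L_family_subset_graph_family[OF assms(2) \<Gamma>] by (simp add: minimal_on_def)
    then show ?thesis
      using L_family_if_J_index_le[OF assms(1,2,5) less G] J_index_L_family[OF assms(2) \<Gamma>] by simp
  qed
  ultimately show ?thesis by blast
qed

end
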